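(* Let $n \ge 1$ be an integer and let $(A,B,W)$ be a partition of $\{0,1\}^n$ such that $\mu(A) = 1/2$. Then $$|\nabla(A,B)| + n^{0.53}\,|W| \;\ge\; 2^{n-1}.$$
   Context: The hypercube $\{0,1\}^n$ is regarded as a graph in which two vertices are adjacent iff they differ in exactly one coordinate. $\mu$ is the uniform probability measure on $\{0,1\}^n$, and $|\cdot|$ denotes cardinality. A partition $(A,B,W)$ means that $A,B,W$ are pairwise disjoint (possibly empty) with union $\{0,1\}^n$. $\nabla(A,B) = \{(x,y) : x \in A,\ y \in B,\ x \text{ and } y \text{ adjacent}\}$ is the set of edges between $A$ and $B$. *)

theory Defs
  imports "HOL-Probability.Probability"
begin

text \<open>Points of \<open>{0,1}\<^sup>n\<close> are Boolean lists of length \<open>n\<close>, with \<open>False\<close> for 0 and \<open>True\<close> for 1.\<close>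

definition hypercube :: "nat \<Rightarrow> bool list set" where
  "hypercube n = {x. length x = n}"

definition cube_adj :: "nat \<Rightarrow> bool list \<Rightarrow> bool list \<Rightarrow> bool" where
  "cube_adj n x y \<longleftrightarrow>
     x \<in> hypercube n \<and> y \<in> hypercube n \<and> (\<exists>!i. i < n \<and> x ! i \<noteq> y ! i)"

definition cube_measure :: "nat \<Rightarrow> bool list measure" where
  "cube_measure n = uniform_count_measure (hypercube n)"

definition cube_partition ::
    "nat \<Rightarrow> bool list set \<Rightarrow> bool list set \<Rightarrow> bool list set \<Rightarrow> bool" where
  "cube_partition n A B W \<longleftrightarrow>
     A \<union> B \<union> W = hypercube n \<and> A \<inter> B = {} \<and> A \<inter> W = {} \<and> B \<inter> W = {}"

text \<open>For disjoint sets \<open>A\<close> and \<open>B\<close>, each undirected edge between them occurs here as exactly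
  one ordered pair, so the cardinality of this set is the number of such edges.\<close>

definition edges_between ::
    "nat \<Rightarrow> bool list set \<Rightarrow> bool list set \<Rightarrow> (bool list \<times> bool list) set" where
  "edges_between n A B = {(x, y). x \<in> A \<and> y \<in> B \<and> cube_adj n x y}"

end

theory Submission
  imports Defs
begin

text \<open>For \<open>S\<close> in the cube let \<open>h\<^sub>S(x)\<close> be the number of neighbours of \<open>x \<in> S\<close> outside \<open>S\<close>, and put
  \<open>\<beta> = 9/17 < 0.53\<close> and \<open>P(x) = x (1 - x) (5 + 2 x) / 3\<close>. The expectation of \<open>h\<^sub>S\<^sup>\<beta>\<close> over the cube
  (with \<open>h\<^sub>S = 0\<close> off \<open>S\<close>) is at least \<open>P(\<mu>(S))\<close>. For \<open>S = B \<union> W\<close> of measure 1/2 this gives the theorem,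
  because \<open>h\<^sup>\<beta> \<le> h\<close> on \<open>B\<close> and \<open>h \<le> n\<close> on \<open>W\<close>.

  The bound on the expectation is proved by induction on \<open>n\<close>. Let the two halves of \<open>S\<close> have densities
  \<open>x \<le> y\<close>, and let \<open>d = y - x\<close>. On a set of density at least \<open>d\<close> in the denser half, \<open>h\<close> grows by 1, and
  \<open>(h + 1)\<^sup>\<beta> \<ge> \<alpha> + \<gamma> h\<^sup>\<beta>\<close> for suitable slopes, so the step needs
  \<open>\<alpha> d + \<gamma> P(y) \<ge> 2 P((x + y)/2) - P(x)\<close>. As \<open>P\<close> is a cubic, the right-hand side equals
  \<open>P(y) + d\<^sup>2 (1 + 2 y - d) / 2\<close>. For small \<open>d / P(y)\<close> the slopes are optimised as a function of \<open>d\<close>;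
  for larger ratios three fixed pairs of slopes suffice.\<close>

section \<open>Concavity of powers and admissible slopes\<close>

lemma powr_chord_le:
  fixes p s u v :: real
  assumes p: "0 \<le> p" "p \<le> 1" and s: "0 \<le> s" "s \<le> 1" and uv: "0 \<le> u" "0 \<le> v"
  shows "s * u powr p + (1 - s) * v powr p \<le> (s * u + (1 - s) * v) powr p"
proof -
  define S where "S = s * u + (1 - s) * v"
  have S0: "0 \<le> S" unfolding S_def using s uv by simp
  show ?thesis
  proof (cases "S = 0")
    case True
    then have "s * u = 0" "(1 - s) * v = 0"
      unfolding S_def using s uv by (smt (verit) mult_nonneg_nonneg)+
    then have "s * u powr p = 0" "(1 - s) * v powr p = 0" by auto
    then have "s * u powr p + (1 - s) * v powr p = 0" by (simp only: add_0_left)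
    then show ?thesis by (metis powr_ge_zero)
  next
    case False
    with S0 have S: "0 < S" by simp
    \<comment> \<open>The tangent of \<open>w powr p\<close> at the mean \<open>S\<close>,
      multiplied by \<open>S powr (1 - p)\<close>. Averaging it over \<open>u\<close> and
      \<open>v\<close> gives concavity.\<close>
    have young: "w powr p * S powr (1 - p) \<le> p * w + (1 - p) * S" if "0 \<le> w" for w
      using Youngs_inequality_0[of p "1 - p" w S] p that S by (cases "w = 0") auto
    have "(s * u powr p + (1 - s) * v powr p) * S powr (1 - p)
        = s * (u powr p * S powr (1 - p)) + (1 - s) * (v powr p * S powr (1 - p))"
      by (simp add: algebra_simps)
    also have "\<dots> \<le> s * (p * u + (1 - p) * S) + (1 - s) * (p * v + (1 - p) * S)"
      using young uv s by (intro add_mono mult_left_mono) auto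
    also have "\<dots> = p * S + (1 - p) * S" by (simp add: S_def algebra_simps)
    also have "\<dots> = S powr p * S powr (1 - p)"
      using S by (simp add: algebra_simps flip: powr_add)
    finally show ?thesis using S by (simp add: S_def)
  qed
qed

text \<open>Turns the numerical bounds below, all with rational exponents, into comparisons of
  integer powers of rationals.\<close>

lemma powr_ge_of_power_le:
  fixes r x p :: real
  assumes "p = real m / real n" "0 < x" "0 \<le> r" "0 < n" "r ^ n \<le> x ^ m"
  shows "r \<le> x powr p"
proof -
  have "(x powr p) ^ n = x ^ m"
    using assms by (simp add: powr_powr flip: powr_realpow)
  with assms show ?thesis by (metis power_mono_iff powr_ge_zero)
qed

text \<open>Only integer \<open>h\<close> matters: the pair \<open>(1, 2\<^sup>\<beta> - 1)\<close> is not admissible for \<open>0 < h < 1\<close>.\<close>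

definition edge_minorant :: "real \<Rightarrow> real \<Rightarrow> real \<Rightarrow> bool" where
  "edge_minorant \<beta> \<alpha> \<gamma> \<longleftrightarrow> 0 \<le> \<alpha> \<and> 0 \<le> \<gamma> \<and> \<gamma> \<le> 1 \<and>
     (\<forall>h::nat. \<alpha> + \<gamma> * real h powr \<beta> \<le> real (h + 1) powr \<beta>)"

text \<open>The points \<open>1 / a\<close> and \<open>h / (1 - a)\<close> with weights
  \<open>a\<close> and \<open>1 - a\<close> have mean \<open>h + 1\<close>, so concavity applies.
  With maximal slopes this is tight at h = (1 - a) / a.\<close>

lemma edge_minorant_holder:
  fixes a \<beta> \<alpha> \<gamma> :: real
  assumes \<beta>: "0 < \<beta>" "\<beta> < 1" and a: "0 < a" "a < 1"
    and \<alpha>: "0 \<le> \<alpha>" "\<alpha> \<le> a powr (1 - \<beta>)"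
    and \<gamma>: "0 \<le> \<gamma>" "\<gamma> \<le> (1 - a) powr (1 - \<beta>)"
  shows "edge_minorant \<beta> \<alpha> \<gamma>"
  unfolding edge_minorant_def
proof (intro conjI allI)
  show "\<gamma> \<le> 1" using \<gamma>(2) a \<beta> powr_le1[of "1 - \<beta>" "1 - a"] by simp
  fix h :: nat
  have "\<alpha> + \<gamma> * real h powr \<beta> \<le> a powr (1 - \<beta>) + (1 - a) powr (1 - \<beta>) * real h powr \<beta>"
    using \<alpha> \<gamma> by (intro add_mono mult_right_mono) auto
  also have "\<dots> = a * (1 / a) powr \<beta> + (1 - a) * (real h / (1 - a)) powr \<beta>"
    using a by (simp add: powr_divide powr_diff)
  also have "\<dots> \<le> (a * (1 / a) + (1 - a) * (real h / (1 - a))) powr \<beta>"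
    using a \<beta> by (intro powr_chord_le) auto
  also have "\<dots> = real (h + 1) powr \<beta>" using a by (simp add: add.commute)
  finally show "\<alpha> + \<gamma> * real h powr \<beta> \<le> real (h + 1) powr \<beta>" .
qed (use \<alpha> \<gamma> in auto)

text \<open>For the largest \<gamma> the claim is 1 + (2h)^\<beta> \<le> h^\<beta> + (h +
  1)^\<beta>. Both pairs have sum 2h + 1, and for h \<ge> 1 the right-hand pair lies between 1 and
  2h, so concavity gives it.\<close>

lemma edge_minorant_one:
  fixes \<beta> \<gamma> :: real
  assumes \<beta>: "0 < \<beta>" "\<beta> < 1" and \<gamma>: "0 \<le> \<gamma>" "\<gamma> \<le> 2 powr \<beta> - 1"
  shows "edge_minorant \<beta> 1 \<gamma>"
  unfolding edge_minorant_def
proof (intro conjI allI)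
  have "2 powr \<beta> \<le> 2 powr (1::real)" using \<beta> by (intro powr_mono) auto
  with \<gamma> show "\<gamma> \<le> 1" by simp
  fix h :: nat
  show "1 + \<gamma> * real h powr \<beta> \<le> real (h + 1) powr \<beta>"
  proof (cases "h = 0")
    case False
    then have h: "1 \<le> real h" by simp
    define s where "s = real h / (2 * real h - 1)"
    have s: "0 \<le> s" "s \<le> 1" unfolding s_def using h by (auto simp: field_simps)
    have "s * (2 * real h - 1) = real h" unfolding s_def using h by simp
    then have e1: "s * 1 + (1 - s) * (2 * real h) = real h"
      and e2: "(1 - s) * 1 + (1 - (1 - s)) * (2 * real h) = real h + 1"
      by (simp_all add: algebra_simps)
    have "s * 1 powr \<beta> + (1 - s) * (2 * real h) powr \<beta> \<le> real h powr \<beta>"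
      using powr_chord_le[of \<beta> s 1 "2 * real h"] \<beta> s h unfolding e1 by simp
    moreover have "(1 - s) * 1 powr \<beta> + (1 - (1 - s)) * (2 * real h) powr \<beta> \<le> (real h + 1) powr \<beta>"
      using powr_chord_le[of \<beta> "1 - s" 1 "2 * real h"] \<beta> s h unfolding e2 by simp
    ultimately have "1 + (2 * real h) powr \<beta> \<le> real h powr \<beta> + (real h + 1) powr \<beta>"
      by (simp add: algebra_simps)
    moreover have "\<gamma> * real h powr \<beta> \<le> (2 powr \<beta> - 1) * real h powr \<beta>"
      using \<gamma> by (intro mult_right_mono) auto
    ultimately show ?thesis by (simp add: powr_mult algebra_simps)
  qed simp
qed (use \<gamma> in auto)

lemma edge_minorant_quarter: "edge_minorant (9/17) (13/25) (873/1000)"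
proof (rule edge_minorant_holder[where a = "1/4"])
  show "13 / 25 \<le> (1/4::real) powr (1 - 9/17)"
    by (rule powr_ge_of_power_le[where m = 8 and n = 17]) (simp_all add: power_divide)
  show "873 / 1000 \<le> (1 - 1/4::real) powr (1 - 9/17)"
    by (rule powr_ge_of_power_le[where m = 8 and n = 17]) (simp_all add: power_divide)
qed auto

lemma edge_minorant_half: "edge_minorant (9/17) (451/625) (451/625)"
proof (rule edge_minorant_holder[where a = "1/2"])
  show "451/625 \<le> (1/2::real) powr (1 - 9/17)"
    by (rule powr_ge_of_power_le[where m = 8 and n = 17]) (simp_all add: power_divide)
  then show "451/625 \<le> (1 - 1/2::real) powr (1 - 9/17)" by simp
qed auto

lemma edge_minorant_full: "edge_minorant (9/17) 1 (4433/10000)"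
proof (rule edge_minorant_one)
  have "14433/10000 \<le> (2::real) powr (9/17)"
    by (rule powr_ge_of_power_le[where m = 9 and n = 17]) (simp_all add: power_divide)
  then show "4433/10000 \<le> (2::real) powr (9/17) - 1" by linarith
qed auto

text \<open>Taking \<open>a\<close> with \<open>a powr (8/17) = \<alpha>\<close> makes the first
  slope bound exact. On [0, 1/5] the concave functions \<open>(1 - a) powr (8/17)\<close> and
  \<open>a powr (16/17)\<close>, the latter being \<open>\<alpha>\<^sup>2\<close>, lie above their
  chords. Eliminating \<open>a\<close> leaves the coefficient 997/2195 < 5/11.\<close>

lemma edge_minorant_small:
  fixes \<alpha> :: real
  assumes "0 \<le> \<alpha>" "\<alpha> \<le> 117/250"
  shows "edge_minorant (9/17) \<alpha> (1 - 5/11 * \<alpha>\<^sup>2)"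
proof (cases "\<alpha> = 0")
  case True
  then show ?thesis by (auto simp: edge_minorant_def intro!: powr_mono2)
next
  case False
  with assms have \<alpha>: "0 < \<alpha>" by simp
  define a where "a = \<alpha> powr (17/8)"
  have a_powr: "a powr (8/17) = \<alpha>" unfolding a_def using \<alpha> by (simp add: powr_powr)
  have a0: "0 < a" unfolding a_def using \<alpha> by simp
  have fifth: "117/250 \<le> (1/5::real) powr (8/17)"
    by (rule powr_ge_of_power_le[where m = 8 and n = 17]) (simp_all add: power_divide)
  have "a \<le> 1/5"
  proof (rule ccontr)
    assume "\<not> a \<le> 1/5"
    then have "(1/5) powr (8/17) < a powr (8/17)" by (intro powr_less_mono2) auto
    with fifth assms a_powr show False by linarith
  qed
  then have s: "0 \<le> 5 * a" "5 * a \<le> 1" using a0 by auto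
  have "9003/10000 \<le> (4/5::real) powr (8/17)"
    by (rule powr_ge_of_power_le[where m = 8 and n = 17]) (simp_all add: power_divide)
  from mult_left_mono[OF this s(1)]
  have "5 * a * (9003/10000) \<le> 5 * a * (4/5) powr (8/17)" .
  moreover have "5 * a * (4/5) powr (8/17) + (1 - 5 * a) * 1 powr (8/17)
      \<le> (5 * a * (4/5) + (1 - 5 * a) * 1) powr (8/17)"
    using s by (intro powr_chord_le) auto
  ultimately have A: "1 - 5 * a * (997/10000) \<le> (1 - a) powr (8/17)"
    by (simp add: algebra_simps)
  have "2195/10000 \<le> (1/5::real) powr (16/17)"
    by (rule powr_ge_of_power_le[where m = 16 and n = 17]) (simp_all add: power_divide)
  from mult_left_mono[OF this s(1)]
  have "5 * a * (2195/10000) \<le> 5 * a * (1/5) powr (16/17)" .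
  moreover have "5 * a * (1/5) powr (16/17) + (1 - 5 * a) * 0 powr (16/17)
      \<le> (5 * a * (1/5) + (1 - 5 * a) * 0) powr (16/17)"
    using s by (intro powr_chord_le) auto
  moreover have "a powr (16/17) = \<alpha>\<^sup>2"
    using a_powr[symmetric] by (simp add: power2_eq_square flip: powr_add)
  ultimately have B: "5 * a * (2195/10000) \<le> \<alpha>\<^sup>2" by simp
  have le: "1 - 5/11 * \<alpha>\<^sup>2 \<le> (1 - a) powr (8/17)" using A B a0 by simp
  have "\<alpha>\<^sup>2 \<le> (117/250)\<^sup>2" using assms by (intro power_mono) auto
  then have nonneg: "0 \<le> 1 - 5/11 * \<alpha>\<^sup>2" by (simp add: power2_eq_square)
  show ?thesis
    by (rule edge_minorant_holder[where a = a])
      (use a0 \<open>a \<le> 1/5\<close> le nonneg a_powr \<alpha> in auto)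
qed

section \<open>The cubic profile and the two-point inequality\<close>

definition profile :: "real \<Rightarrow> real" where
  "profile x = x * (1 - x) * (5 + 2 * x) / 3"

lemma profile_nonneg: "0 \<le> x \<Longrightarrow> x \<le> 1 \<Longrightarrow> 0 \<le> profile x"
  by (simp add: profile_def)

lemma profile_midpoint:
  "2 * profile ((x + y) / 2)
    = profile x + profile y + (y - x)\<^sup>2 * (1 + 2 * y - (y - x)) / 2"
  by (simp add: profile_def power2_eq_square field_simps)

text \<open>Supplies the node condition of \<open>cubic_below_line\<close> when all three nodes are
  at most \<open>profile y\<close>.\<close>

lemma three_profile_le:
  assumes "0 \<le> y" "y \<le> 1" shows "3 * profile y \<le> 1 + 2 * y"
proof -
  have "1 + 2 * y - 3 * profile y = (1 - y)^3 + 3 * y^3"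
    by (simp add: profile_def power3_eq_cube field_simps)
  moreover have "0 \<le> (1 - y)^3 + 3 * y^3" using assms by simp
  ultimately show ?thesis by linarith
qed

text \<open>After replacing the square of the profile by a tangent, each of the following claims is the
  nonnegativity of a quartic. Dividing it by \<open>(y - r)\<^sup>2\<close>, with \<open>r\<close> near its minimiser, leaves a positive
  quadratic and a linear remainder that is positive on \<open>[0, 1]\<close>.\<close>

lemma profile_weighted_le_0:
  assumes "0 \<le> y" "y \<le> 1" shows "profile y * (1 + 2 * y) \<le> 11/10"
proof -
  have "0 \<le> (y - 3191/5000)\<^sup>2 * (4 * y\<^sup>2 + 8191/625 * y + 50617443/6250000)"
    using assms by (intro mult_nonneg_nonneg) auto
  then show ?thesis using assms
    by (simp add: profile_def power2_eq_square field_simps)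
qed

lemma profile_weighted_le_42:
  assumes "0 \<le> y" "y \<le> 1"
  shows "profile y * (1 + 2 * y) - 42/100 * (profile y)\<^sup>2 \<le> 103/100"
proof -
  have "0 \<le> (y - 13/20)\<^sup>2 * (4 * y\<^sup>2 + 7746/625 * y + 77651/12500)"
    using assms by (intro mult_nonneg_nonneg) auto
  then have "profile y * (1 + 2 * y) - 42/100 * (2 * (48/100) * profile y - (48/100)\<^sup>2) \<le> 103/100"
    using assms by (simp add: profile_def power2_eq_square field_simps)
  moreover have "42/100 * (2 * (48/100) * profile y - (48/100)\<^sup>2) \<le> 42/100 * (profile y)\<^sup>2"
    using sum_squares_bound[of "48/100" "profile y"] by (simp add: power2_eq_square)
  ultimately show ?thesis by linarith
qed

lemma profile_weighted_le_75:
  assumes "0 \<le> y" "y \<le> 1"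
  shows "profile y * (1 + 2 * y) - 75/100 * (profile y)\<^sup>2 \<le> 934/1000"
proof -
  have "0 \<le> (y - 67/100)\<^sup>2 * (4 * y\<^sup>2 + 239/20 * y + 3189/625)"
    using assms by (intro mult_nonneg_nonneg) auto
  then have "profile y * (1 + 2 * y) - 75/100 * (2 * (47/100) * profile y - (47/100)\<^sup>2) \<le> 934/1000"
    using assms by (simp add: profile_def power2_eq_square field_simps)
  moreover have "75/100 * (2 * (47/100) * profile y - (47/100)\<^sup>2) \<le> 75/100 * (profile y)\<^sup>2"
    using sum_squares_bound[of "47/100" "profile y"] by (simp add: power2_eq_square)
  ultimately show ?thesis by linarith
qed

lemma profile_weighted_le_100:
  assumes "0 \<le> y" "y \<le> 1"
  shows "profile y * (1 + 2 * y) - (profile y)\<^sup>2 \<le> 882/1000"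
proof -
  have "0 \<le> (y - 171/250)\<^sup>2 * (4 * y\<^sup>2 + 1454/125 * y + 66893/15625)"
    using assms by (intro mult_nonneg_nonneg) auto
  then have "profile y * (1 + 2 * y) - (2 * (46/100) * profile y - (46/100)\<^sup>2) \<le> 882/1000"
    using assms by (simp add: profile_def power2_eq_square field_simps)
  moreover have "2 * (46/100) * profile y - (46/100)\<^sup>2 \<le> (profile y)\<^sup>2"
    using sum_squares_bound[of "46/100" "profile y"] by (simp add: power2_eq_square)
  ultimately show ?thesis by linarith
qed

text \<open>The condition on \<open>d + d1 + d2\<close> says that the second divided difference of \<open>t\<^sup>2 (c - t)\<close> at
  these nodes, which is \<open>c - (d + d1 + d2)\<close>, is nonnegative.\<close>

lemma cubic_below_line:
  fixes c d d1 d2 p q :: real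
  assumes d: "d1 \<le> d" "d \<le> d2" "d + d1 + d2 \<le> c"
    and le1: "d1\<^sup>2 * (c - d1) / 2 \<le> p * d1 - q"
    and le2: "d2\<^sup>2 * (c - d2) / 2 \<le> p * d2 - q"
  shows "d\<^sup>2 * (c - d) / 2 \<le> p * d - q"
proof (cases "d1 = d2")
  case True
  with d le1 show ?thesis by simp
next
  case False
  with d have lt: "0 < d2 - d1" by simp
  define g where "g t = p * t - q - t\<^sup>2 * (c - t) / 2" for t
  have "(d2 - d1) * g d = (d2 - d) * g d1 + (d - d1) * g d2
      + (d2 - d1) * (d2 - d) * (d - d1) * (c - (d + d1 + d2)) / 2"
    by (simp add: g_def power2_eq_square field_simps)
  moreover have "0 \<le> (d2 - d) * g d1 + (d - d1) * g d2
      + (d2 - d1) * (d2 - d) * (d - d1) * (c - (d + d1 + d2)) / 2"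
    using d le1 le2 lt unfolding g_def
    by (intro add_nonneg_nonneg divide_nonneg_pos mult_nonneg_nonneg) auto
  ultimately have "0 \<le> (d2 - d1) * g d" by simp
  then have "0 \<le> g d" using lt by (simp add: zero_le_mult_iff)
  then show ?thesis by (simp add: g_def)
qed

text \<open>At \<open>d = t * b\<close> a factor \<open>b\<close> splits off. What remains is a
  bound \<open>M\<close> from the \<open>profile_weighted_le\<close> lemmas and a purely numerical
  condition on \<open>t\<close>.\<close>

lemma endpoint_bound:
  fixes b t y \<alpha> \<gamma> M :: real
  assumes "0 \<le> b" "b * (1 + 2 * y) - t * b\<^sup>2 \<le> M" "t\<^sup>2 * M / 2 \<le> \<alpha> * t - (1 - \<gamma>)"
  shows "(t * b)\<^sup>2 * ((1 + 2 * y) - t * b) / 2 \<le> \<alpha> * (t * b) - (1 - \<gamma>) * b"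
proof -
  have "(t * b)\<^sup>2 * ((1 + 2 * y) - t * b) / 2 = b * (t\<^sup>2 * (b * (1 + 2 * y) - t * b\<^sup>2) / 2)"
    by (simp add: power2_eq_square algebra_simps)
  also have "\<dots> \<le> b * (t\<^sup>2 * M / 2)"
    using assms by (intro mult_left_mono divide_right_mono) auto
  also have "\<dots> \<le> b * (\<alpha> * t - (1 - \<gamma>))" using assms by (intro mult_left_mono) auto
  finally show ?thesis by (simp add: algebra_simps)
qed

lemma two_point_gain:
  fixes d y :: real
  assumes d: "0 \<le> d" "d \<le> y" "y \<le> 1"
  shows "\<exists>\<alpha> \<gamma>. edge_minorant (9/17) \<alpha> \<gamma> \<and>
    profile y + d\<^sup>2 * (1 + 2 * y - d) / 2 \<le> \<alpha> * d + \<gamma> * profile y"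
    (is "?P (profile y)")
proof -
  define b where "b = profile y"
  have y: "0 \<le> y" "y \<le> 1" using d by auto
  have b0: "0 \<le> b" using profile_nonneg[OF y] by (simp add: b_def)
  have b3: "3 * b \<le> 1 + 2 * y" using three_profile_le[OF y] by (simp add: b_def)
  have M0: "b * (1 + 2 * y) \<le> 11/10" using profile_weighted_le_0[OF y] by (simp add: b_def)
  have M1: "b * (1 + 2 * y) - 42/100 * b\<^sup>2 \<le> 103/100"
    using profile_weighted_le_42[OF y] by (simp add: b_def)
  have M2: "b * (1 + 2 * y) - 75/100 * b\<^sup>2 \<le> 934/1000"
    using profile_weighted_le_75[OF y] by (simp add: b_def)
  have M3: "b * (1 + 2 * y) - 1 * b\<^sup>2 \<le> 882/1000"
    using profile_weighted_le_100[OF y] by (simp add: b_def)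
  have *: "?P b"
    if "edge_minorant (9/17) \<alpha> \<gamma>" "d\<^sup>2 * ((1 + 2 * y) - d) / 2 \<le> \<alpha> * d - (1 - \<gamma>) * b" for \<alpha> \<gamma>
    using that by (intro exI[of _ \<alpha>] exI[of _ \<gamma>]) (simp add: algebra_simps)
  \<comment> \<open>Each fixed pair of slopes is checked only at the ends of its range of
    \<open>d\<close>; \<open>cubic_below_line\<close> fills in the interior.\<close>
  consider (a) "d \<le> 42/100 * b" | (b) "42/100 * b \<le> d" "d \<le> 75/100 * b"
    | (c) "75/100 * b \<le> d" "d \<le> 1 * b" | (d) "1 * b \<le> d" by linarith
  then have "?P b"
  proof cases
    case a
    \<comment> \<open>This maximises \<open>\<alpha> * d - 5/11 * \<alpha>\<^sup>2 * b\<close>; the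
      maximum 11 d^2 / (20 b) suffices by \<open>M0\<close>. If \<open>b = 0\<close>, then
      \<open>d = 0\<close> and division by zero yields \<alpha> = 0.\<close>
    define \<alpha> where "\<alpha> = 11 * d / (10 * b)"
    have \<alpha>: "0 \<le> \<alpha>" "\<alpha> \<le> 117/250" unfolding \<alpha>_def using a b0 d
      by (auto simp: divide_le_eq)
    have "d\<^sup>2 * ((1 + 2 * y) - d) / 2 \<le> \<alpha> * d - (1 - (1 - 5/11 * \<alpha>\<^sup>2)) * b"
    proof (cases "b = 0")
      case True
      with a d show ?thesis by simp
    next
      case False
      with b0 have b: "0 < b" by simp
      have "1 + 2 * y \<le> 11 / (10 * b)" using b M0 by (simp add: field_simps)
      then have "d\<^sup>2 * ((1 + 2 * y) - d) \<le> d\<^sup>2 * (11 / (10 * b))"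
        using d by (intro mult_left_mono) auto
      also have "\<dots> = 2 * (\<alpha> * d - (1 - (1 - 5/11 * \<alpha>\<^sup>2)) * b)"
        using b by (simp add: \<alpha>_def power2_eq_square field_simps)
      finally show ?thesis by simp
    qed
    then show ?thesis by (rule *[OF edge_minorant_small[OF \<alpha>]])
  next
    case b
    show ?thesis
    proof (rule *[OF edge_minorant_quarter], rule cubic_below_line[OF b])
      show "d + 42/100 * b + 75/100 * b \<le> 1 + 2 * y" using b b0 b3 by linarith
      show "(42/100 * b)\<^sup>2 * (1 + 2 * y - 42/100 * b) / 2 \<le> 13/25 * (42/100 * b) - (1 - 873/1000) * b"
        by (rule endpoint_bound[OF b0 M1]) (simp add: power2_eq_square)
      show "(75/100 * b)\<^sup>2 * (1 + 2 * y - 75/100 * b) / 2 \<le> 13/25 * (75/100 * b) - (1 - 873/1000) * b"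
        by (rule endpoint_bound[OF b0 M2]) (simp add: power2_eq_square)
    qed
  next
    case c
    show ?thesis
    proof (rule *[OF edge_minorant_half], rule cubic_below_line[OF c])
      show "d + 75/100 * b + 1 * b \<le> 1 + 2 * y" using c b0 b3 by linarith
      show "(75/100 * b)\<^sup>2 * (1 + 2 * y - 75/100 * b) / 2 \<le> 451/625 * (75/100 * b) - (1 - 451/625) * b"
        by (rule endpoint_bound[OF b0 M2]) (simp add: power2_eq_square)
      show "(1 * b)\<^sup>2 * (1 + 2 * y - 1 * b) / 2 \<le> 451/625 * (1 * b) - (1 - 451/625) * b"
        by (rule endpoint_bound[OF b0 M3]) (simp add: power2_eq_square)
    qed
  next
    case d': d
    show ?thesis
    proof (rule *[OF edge_minorant_full], rule cubic_below_line[OF d' d(2)])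
      \<comment> \<open>Here \<open>d\<close> may exceed the profile, so the node sum is bounded
        through b \<le> d \<le> y \<le> 1. The upper node \<open>y\<close> corresponds to an empty
        sparser half.\<close>
      show "d + 1 * b + y \<le> 1 + 2 * y" using d d' by linarith
      show "(1 * b)\<^sup>2 * (1 + 2 * y - 1 * b) / 2 \<le> 1 * (1 * b) - (1 - 4433/10000) * b"
        by (rule endpoint_bound[OF b0 M3]) simp
      have "1 * y - (1 - 4433/10000) * b - y\<^sup>2 * ((1 + 2 * y) - y) / 2
          = y * (1 - y) * ((2 + y) / 2 - 5567/10000 * (5 + 2 * y) / 3)"
        by (simp add: b_def profile_def power2_eq_square field_simps)
      moreover have "0 \<le> y * (1 - y) * ((2 + y) / 2 - 5567/10000 * (5 + 2 * y) / 3)"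
        using y by (intro mult_nonneg_nonneg) auto
      ultimately show "y\<^sup>2 * ((1 + 2 * y) - y) / 2 \<le> 1 * y - (1 - 4433/10000) * b" by linarith
    qed
  qed
  then show ?thesis by (simp only: b_def)
qed

section \<open>Out-degrees and induction on the dimension\<close>

definition out_degree :: "bool list set \<Rightarrow> bool list \<Rightarrow> nat" where
  "out_degree S x = card {i. i < length x \<and> x[i := \<not> x ! i] \<notin> S}"

text \<open>The terms come from flipping the head and from flips within the section. As
  \<open>out_degree\<close> reads the dimension off the list, it applies to the section
  unchanged.\<close>

lemma out_degree_Cons:
  "out_degree S (a # x) = (if (\<not> a) # x \<in> S then 0 else 1) + out_degree {z. a # z \<in> S} x"
proof -
  let ?I = "{i. i < length x \<and> x[i := \<not> x ! i] \<notin> {z. a # z \<in> S}}"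
  have "{i. i < length (a # x) \<and> (a # x)[i := \<not> (a # x) ! i] \<notin> S}
      = (if (\<not> a) # x \<in> S then {} else {0}) \<union> Suc ` ?I"
    by (auto simp: less_Suc_eq_0_disj split: if_splits)
  moreover have "card ((if (\<not> a) # x \<in> S then {} else {0}) \<union> Suc ` ?I)
      = (if (\<not> a) # x \<in> S then 0 else 1) + card ?I"
    by (subst card_Un_disjoint) (auto simp: card_image)
  ultimately show ?thesis by (simp add: out_degree_def)
qed

lemma finite_hypercube: "finite (hypercube n)"
  and card_hypercube: "card (hypercube n) = 2 ^ n"
  using finite_lists_length_eq[of "UNIV :: bool set" n] card_lists_length_eq[of "UNIV :: bool set" n]
  by (simp_all add: hypercube_def)

text \<open>The first bit \<open>a\<close> is arbitrary so that the induction can let it name the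
  denser half.\<close>

lemma sum_Cons_split:
  fixes f :: "bool list \<Rightarrow> 'a::comm_monoid_add"
  assumes S: "S \<subseteq> hypercube (Suc n)"
  shows "sum f S = (\<Sum>z | a # z \<in> S. f (a # z)) + (\<Sum>z | (\<not> a) # z \<in> S. f ((\<not> a) # z))"
proof -
  have fin: "finite S" using S finite_hypercube finite_subset by blast
  have "S = (\<lambda>z. a # z) ` {z. a # z \<in> S} \<union> (\<lambda>z. (\<not> a) # z) ` {z. (\<not> a) # z \<in> S}"
    (is "_ = ?A \<union> ?B")
  proof (intro equalityI subsetI)
    fix x assume x: "x \<in> S"
    with S obtain c z where "x = c # z" by (cases x) (auto simp: hypercube_def)
    with x show "x \<in> ?A \<union> ?B" by (cases "c = a") auto
  qed auto
  moreover have "?A \<inter> ?B = {}" by auto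
  moreover have "finite ?A" "finite ?B" by (rule finite_subset[OF _ fin]; auto)+
  ultimately have "sum f S = sum f ?A + sum f ?B" using sum.union_disjoint by metis
  then show ?thesis by (simp add: sum.reindex)
qed

theorem out_degree_isoperimetry:
  assumes "S \<subseteq> hypercube n"
  shows "2 ^ n * profile (card S / 2 ^ n) \<le> (\<Sum>x\<in>S. out_degree S x powr (9/17))"
  using assms
proof (induction n arbitrary: S)
  case 0
  then have "S = {} \<or> S = {[]}" by (auto simp: hypercube_def)
  \<comment> \<open>The density is 0 or 1, where the profile vanishes.\<close>
  then show ?case by (auto simp: profile_def)
next
  case (Suc n)
  define T where "T a = {z. a # z \<in> S}" for a
  obtain a where a: "card (T (\<not> a)) \<le> card (T a)"
    using linear[of "card (T True)" "card (T False)"] that[of True] that[of False] by auto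
  define X Y where "X = T (\<not> a)" and "Y = T a"
  have XY: "X \<subseteq> hypercube n" "Y \<subseteq> hypercube n"
    using Suc.prems by (auto simp: X_def Y_def T_def hypercube_def)
  have fin: "finite X" "finite Y" using XY finite_hypercube finite_subset by blast+
  define x y where "x = card X / 2 ^ n" and "y = card Y / 2 ^ n"
  have "card Y \<le> 2 ^ n" using card_mono[OF finite_hypercube XY(2)] by (simp add: card_hypercube)
  then have "card Y \<le> (2::real) ^ n" by (metis of_nat_le_iff of_nat_numeral of_nat_power)
  then have y1: "y \<le> 1" by (simp add: y_def)
  have xy: "0 \<le> x" "x \<le> y" using a by (auto simp: x_def y_def X_def Y_def divide_right_mono)
  obtain \<alpha> \<gamma> where m: "edge_minorant (9/17) \<alpha> \<gamma>"
    and gain: "profile y + (y - x)\<^sup>2 * (1 + 2 * y - (y - x)) / 2 \<le> \<alpha> * (y - x) + \<gamma> * profile y"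
    using two_point_gain[of "y - x" y] xy y1 by auto
  have \<alpha>: "0 \<le> \<alpha>" and \<gamma>: "0 \<le> \<gamma>" "\<gamma> \<le> 1"
    and step: "\<alpha> + \<gamma> * real h powr (9/17) \<le> real (h + 1) powr (9/17)" for h
    using m by (auto simp: edge_minorant_def)
  have "card S = card X + card Y"
    using sum_Cons_split[OF Suc.prems, of "\<lambda>_. 1::nat" a] by (simp add: X_def Y_def T_def)
  then have mid: "card S / 2 ^ Suc n = (x + y) / 2" by (simp add: x_def y_def field_simps)
  have "2 ^ n * profile x \<le> (\<Sum>z\<in>X. out_degree X z powr (9/17))"
    using Suc.IH[OF XY(1)] by (simp add: x_def)
  \<comment> \<open>Edges from the sparser half across the first coordinate can only raise the
    degree; they are dropped.\<close>
  also have "\<dots> \<le> (\<Sum>z\<in>X. out_degree S ((\<not> a) # z) powr (9/17))"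
    by (intro sum_mono powr_mono2) (auto simp: out_degree_Cons X_def T_def)
  finally have lowX: "2 ^ n * profile x \<le> (\<Sum>z\<in>X. out_degree S ((\<not> a) # z) powr (9/17))" .
  \<comment> \<open>For points of \<open>Y - X\<close>, flipping the first bit leaves
    \<open>S\<close>.\<close>
  have "card Y - card X \<le> card (Y - X)" using fin by (simp add: diff_card_le_card_Diff)
  then have "(y - x) * 2 ^ n \<le> card (Y - X)" by (simp add: x_def y_def left_diff_distrib)
  then have "\<alpha> * ((y - x) * 2 ^ n) + \<gamma> * (2 ^ n * profile y)
      \<le> \<alpha> * card (Y - X) + \<gamma> * (\<Sum>z\<in>Y. out_degree Y z powr (9/17))"
    using Suc.IH[OF XY(2)] \<alpha> \<gamma> by (intro add_mono mult_left_mono) (auto simp: y_def)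
  also have "\<alpha> * card (Y - X) = (\<Sum>z\<in>Y. if z \<in> X then 0 else \<alpha>)"
    using fin by (simp add: sum.If_cases Diff_eq Collect_neg_eq)
  also have "\<dots> + \<gamma> * (\<Sum>z\<in>Y. out_degree Y z powr (9/17))
      = (\<Sum>z\<in>Y. (if z \<in> X then 0 else \<alpha>) + \<gamma> * out_degree Y z powr (9/17))"
    by (simp add: sum.distrib sum_distrib_left)
  also have "\<dots> \<le> (\<Sum>z\<in>Y. out_degree S (a # z) powr (9/17))"
  proof (rule sum_mono)
    fix z
    \<comment> \<open>On \<open>X\<close> the degree is unchanged and \<gamma> \<le> 1 suffices; off
      \<open>X\<close> it grows by one and the minorant applies.\<close>
    have deg: "out_degree S (a # z) = (if z \<in> X then 0 else 1) + out_degree Y z"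
      by (simp add: out_degree_Cons X_def Y_def T_def)
    show "(if z \<in> X then 0 else \<alpha>) + \<gamma> * out_degree Y z powr (9/17)
        \<le> out_degree S (a # z) powr (9/17)"
      unfolding deg using step[of "out_degree Y z"] \<gamma> by (auto simp: mult_left_le_one_le add.commute)
  qed
  finally have lowY: "2 ^ n * (\<alpha> * (y - x) + \<gamma> * profile y)
      \<le> (\<Sum>z\<in>Y. out_degree S (a # z) powr (9/17))" by (simp add: algebra_simps)
  have "2 ^ Suc n * profile (card S / 2 ^ Suc n) = 2 ^ n * (2 * profile ((x + y) / 2))"
    unfolding mid by simp
  also have "\<dots> \<le> 2 ^ n * (profile x + (\<alpha> * (y - x) + \<gamma> * profile y))"
    unfolding profile_midpoint using gain by (intro mult_left_mono) auto
  also have "\<dots> \<le> (\<Sum>z\<in>Y. out_degree S (a # z) powr (9/17))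
      + (\<Sum>z\<in>X. out_degree S ((\<not> a) # z) powr (9/17))"
    using lowX lowY by (simp add: algebra_simps)
  also have "\<dots> = (\<Sum>x\<in>S. out_degree S x powr (9/17))"
    using sum_Cons_split[OF Suc.prems, of "\<lambda>x. out_degree S x powr (9/17)" a]
    by (simp add: X_def Y_def T_def)
  finally show ?case .
qed

section \<open>Counting edges and the final estimate\<close>

lemma card_cube_neighbours:
  assumes "A \<subseteq> hypercube n" "y \<in> hypercube n"
  shows "card {x \<in> A. cube_adj n x y} = out_degree (hypercube n - A) y"
proof -
  \<comment> \<open>A flip stays in the cube, so outside \<open>hypercube n - A\<close> it lands in
    \<open>A\<close>; the flipped index parametrises these neighbours.\<close>
  have "bij_betw (\<lambda>i. y[i := \<not> y ! i]) {i. i < length y \<and> y[i := \<not> y ! i] \<notin> hypercube n - A}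
      {x \<in> A. cube_adj n x y}"
    unfolding bij_betw_def
  proof (intro conjI equalityI subsetI)
    show "inj_on (\<lambda>i. y[i := \<not> y ! i]) {i. i < length y \<and> y[i := \<not> y ! i] \<notin> hypercube n - A}"
    proof (rule inj_onI, rule ccontr)
      fix i j
      assume i: "i \<in> {i. i < length y \<and> y[i := \<not> y ! i] \<notin> hypercube n - A}"
        and eq: "y[i := \<not> y ! i] = y[j := \<not> y ! j]" and ij: "i \<noteq> j"
      have "y[i := \<not> y ! i] ! i \<noteq> y[j := \<not> y ! j] ! i" using i ij by simp
      with eq show False by simp
    qed
  next
    fix x assume "x \<in> (\<lambda>i. y[i := \<not> y ! i]) ` {i. i < length y \<and> y[i := \<not> y ! i] \<notin> hypercube n - A}"
    then obtain i where i: "i < length y" "x = y[i := \<not> y ! i]" "x \<in> A"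
      using assms by (auto simp: hypercube_def)
    then have "\<exists>!i. i < n \<and> x ! i \<noteq> y ! i"
      using assms by (intro ex1I[of _ i]) (auto simp: hypercube_def nth_list_update split: if_splits)
    with i assms show "x \<in> {x \<in> A. cube_adj n x y}" by (auto simp: cube_adj_def)
  next
    fix x assume "x \<in> {x \<in> A. cube_adj n x y}"
    then have x: "x \<in> A" "length x = n" and ex: "\<exists>!i. i < n \<and> x ! i \<noteq> y ! i"
      by (auto simp: cube_adj_def hypercube_def)
    have y: "length y = n" using assms by (simp add: hypercube_def)
    from ex obtain i where i: "i < n \<and> x ! i \<noteq> y ! i"
      and u: "\<forall>j. j < n \<and> x ! j \<noteq> y ! j \<longrightarrow> j = i"
      by (rule ex1E)
    have "x = y[i := \<not> y ! i]"
    proof (rule nth_equalityI)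
      fix j assume j: "j < length x"
      show "x ! j = y[i := \<not> y ! i] ! j"
      proof (cases "j = i")
        case True
        with i y show ?thesis by simp
      next
        case False
        then have "x ! j = y ! j" using u j x(2) by metis
        with False show ?thesis by simp
      qed
    qed (simp add: x y)
    with i x(1) y show "x \<in> (\<lambda>i. y[i := \<not> y ! i]) ` {i. i < length y \<and> y[i := \<not> y ! i] \<notin> hypercube n - A}"
      by auto
  qed
  from bij_betw_same_card[OF this] show ?thesis unfolding out_degree_def by (rule sym)
qed

theorem corollary1p6:
  fixes n :: nat and A B W :: "bool list set"
  assumes "n \<ge> 1"
    and "cube_partition n A B W"
    and "measure (cube_measure n) A = 1 / 2"
  shows "real (card (edges_between n A B)) + real n powr 0.53 * real (card W) \<ge> 2 ^ (n - 1)"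
proof -
  have sub: "A \<subseteq> hypercube n" "B \<subseteq> hypercube n" "W \<subseteq> hypercube n"
    and compl: "hypercube n - A = B \<union> W" and BW: "B \<inter> W = {}"
    using assms(2) by (auto simp: cube_partition_def)
  have fin: "finite A" "finite B" "finite W"
    using sub finite_hypercube finite_subset by blast+
  have "measure (cube_measure n) A = card A / 2 ^ n"
    using sub(1) finite_hypercube
    by (simp add: cube_measure_def measure_uniform_count_measure card_hypercube)
  then have "card A / 2 ^ n = (1/2 :: real)" using assms(3) by linarith
  then have "real (card A) = 2 ^ n / 2" by (simp only: divide_eq_eq) simp
  moreover have "real (card (B \<union> W)) = 2 ^ n - real (card A)"
    using card_Diff_subset[OF fin(1) sub(1)] card_mono[OF finite_hypercube sub(1)]
    by (simp add: compl card_hypercube of_nat_diff)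
  ultimately have half: "card (B \<union> W) / 2 ^ n = (1/2 :: real)"
    by simp
  \<comment> \<open>The profile takes the value 1/2 at 1/2, and n \<ge> 1 keeps \<open>n - 1\<close>
    from being truncated.\<close>
  have "(2::real) ^ (n - 1) = 2 ^ n * profile (card (B \<union> W) / 2 ^ n)"
    using assms(1) unfolding half by (simp add: profile_def power_diff)
  also have "\<dots> \<le> (\<Sum>x\<in>B \<union> W. out_degree (B \<union> W) x powr (9/17))"
    using sub by (intro out_degree_isoperimetry) auto
  also have "\<dots> = (\<Sum>x\<in>B. out_degree (B \<union> W) x powr (9/17))
      + (\<Sum>x\<in>W. out_degree (B \<union> W) x powr (9/17))"
    using fin BW by (simp add: sum.union_disjoint)
  also have "(\<Sum>x\<in>B. out_degree (B \<union> W) x powr (9/17)) \<le> (\<Sum>x\<in>B. real (out_degree (B \<union> W) x))"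
  proof (rule sum_mono)
    fix x
    show "out_degree (B \<union> W) x powr (9/17) \<le> real (out_degree (B \<union> W) x)"
      \<comment> \<open>A natural number is 0, where \<open>powr\<close> gives 0, or at least 1,
        where raising the exponent is monotone.\<close>
      using powr_mono[of "9/17" 1 "real (out_degree (B \<union> W) x)"]
      by (cases "out_degree (B \<union> W) x = 0") auto
  qed
  also have "\<dots> = (\<Sum>y\<in>B. real (card {x \<in> A. cube_adj n x y}))"
    using sub by (intro sum.cong) (auto simp: card_cube_neighbours compl)
  also have "\<dots> = real (card (SIGMA y:B. {x \<in> A. cube_adj n x y}))"
    using fin by (subst card_SigmaI) auto
  \<comment> \<open>The \<open>SIGMA\<close> pairs list the endpoint in \<open>B\<close> first,
    hence the swap.\<close>
  also have "card (SIGMA y:B. {x \<in> A. cube_adj n x y}) = card (edges_between n A B)"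
    by (rule bij_betw_same_card[of prod.swap])
      (auto simp: bij_betw_def inj_on_def edges_between_def image_iff)
  also have "(\<Sum>x\<in>W. out_degree (B \<union> W) x powr (9/17)) \<le> (\<Sum>x\<in>W. real n powr (9/17))"
  proof (intro sum_mono powr_mono2)
    fix x assume "x \<in> W"
    then have "length x = n" using sub by (auto simp: hypercube_def)
    moreover have "out_degree (B \<union> W) x \<le> card {..<length x}"
      unfolding out_degree_def by (intro card_mono) auto
    ultimately show "real (out_degree (B \<union> W) x) \<le> real n" by simp
  qed auto
  also have "(\<Sum>x\<in>W. real n powr (9/17)) \<le> (\<Sum>x\<in>W. real n powr 0.53)"
    using assms(1) by (intro sum_mono powr_mono) auto
  finally show ?thesis by (simp add: mult.commute)
qed

end
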